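(* Let $S\subset\mathbb{R}^n$ be nonempty, convex and compact, let $f:\mathbb{R}^n\to\mathbb{R}$ be convex, let $f^*=\min_{x\in S}f(x)$ and let $x^*\in S$ be any minimizer of $f$ over $S$. Let $\{y^k\}$, $\{x^k\}$ be generated by the Fast Doubly Stabilized Algorithm (FDSA) described in the context, with positive proximity parameters $\{\mu_k\}_{k\ge 0}$ and with $\beta_k=0$ for all $k\ge 0$. For each $k$ let $t_k$ be the optimal dual solution (Lagrange multiplier) associated with the constraint $\check f_k(x)\le r$ in the problem $$\min_{(x,r)\in S\times\mathbb{R}}\Big\{r+\tfrac{\mu_k}{2}\|x-x^k\|^2:\ \check f_k(x)\le r,\ r\le l_k\Big\}.$$ Given some $\mu>0$, assume that $\mu_0=\mu$ and $\mu_kt_{k-1}\le\mu_{k-1}t_k$ for all $k\ge1$. Then $$f(y^k)-f^*\le\frac{2\mu\|x^0-x^*\|^2}{t_0(k+1)^2}+\vartheta_k,\qquad k\ge1,$$ where $\vartheta_k=\lambda_{k-1}^{-2}\sum_{i=0}^{k-1}\lambda_i^2\varepsilon_i$ and $\varepsilon_i=f(y^{i+1})-\check f_i(y^{i+1})$.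
   Context: $\|\cdot\|$ and $\langle\cdot,\cdot\rangle$ are the Euclidean norm and inner product on $\mathbb{R}^n$; $\partial f$ is the convex subdifferential. Nesterov's sequence: $\lambda_0=1$, $\lambda_{k+1}=\frac{1+\sqrt{1+4\lambda_k^2}}{2}$ for $k\ge0$. Set $\alpha_k=\lambda_{k+1}^{-1}(\lambda_k-1)$. Cutting-plane model: given the points $y^0,\dots,y^k$ generated so far and subgradients $g^i\in\partial f(y^i)$, the bundle at step $k$ consists of the triples $(y^i,f(y^i),g^i)$, $i=0,\dots,k$, and $$\check f_k(x)=\max_{0\le i\le k}\{f(y^i)+\langle g^i,x-y^i\rangle\},$$ so that $\check f_k\le f$. Level: $\kappa\in(0,1)$ is a fixed level parameter; $f_{\text{best}}^k$ is the best objective value found up to step $k$ (the smallest of the values $f(y^0),\dots,f(y^k)$); $f_{\text{low}}^k$ is a finite lower bound on $f^*$; $\Delta_k=f_{\text{best}}^k-f_{\text{low}}^k\ge0$; and $l_k=f_{\text{best}}^k-\kappa\Delta_k$. Fast Doubly Stabilized Algorithm (FDSA), with stopping tolerance $\varepsilon$, proximity parameters $\mu_k>0$ and a sequence $\{\beta_k\}_{k\ge0}$: choose $x^0=y^0\in\mathbb{R}^n$. For $k=0,1,2,\dots$: 1. compute $f(y^k)$ and $g^k\in\partial f(y^k)$ and update the bundle; 2. update $f_{\text{best}}^k$, $f_{\text{low}}^k$, $\Delta_k$, $l_k$; 3. stop if $\Delta_k\le\varepsilon$ or $g^k=0$; 4. let $y^{k+1}$ be the $x$-component of the solution of $\min_{(x,r)\in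 S\times\mathbb{R}}\{r+\frac{\mu_k}{2}\|x-x^k\|^2:\ \check f_k(x)\le r,\ r\le l_k\}$, and set $x^{k+1}=y^{k+1}+\alpha_k(y^{k+1}-y^k)+\beta_k(y^{k+1}-x^k)$. The estimate concerns all $k\ge1$ for which $y^k$ is generated. The Lagrange multipliers $t_k,\tau_k\ge0$ of the constraints $\check f_k(x)\le r$ and $r\le l_k$ satisfy the KKT conditions: with $r^k$ the $r$-component of the solution, there are $p_f^k\in\partial\check f_k(y^{k+1})$ and $p_S^k$ in the normal cone of $S$ at $y^{k+1}$ with $\mu_k(y^{k+1}-x^k)+t_k(p_f^k+p_S^k)=0$, $t_k[\check f_k(y^{k+1})-r^k]=0$, $1-t_k+\tau_k=0$, $\tau_k(r^k-l_k)=0$. *)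

theory Defs
  imports "HOL-Analysis.Analysis"
begin

fun nesterov :: "nat \<Rightarrow> real" where
  "nesterov 0 = 1"
| "nesterov (Suc k) = (1 + sqrt (1 + 4 * (nesterov k)\<^sup>2)) / 2"

definition nesterov_step :: "nat \<Rightarrow> real" where
  "nesterov_step k = (nesterov k - 1) / nesterov (Suc k)"

definition subdifferential :: "('a::real_inner \<Rightarrow> real) \<Rightarrow> 'a \<Rightarrow> 'a set" where
  "subdifferential f x = {g. \<forall>z. f z \<ge> f x + g \<bullet> (z - x)}"

definition cp_model ::
  "('a::real_inner \<Rightarrow> real) \<Rightarrow> (nat \<Rightarrow> 'a) \<Rightarrow> (nat \<Rightarrow> 'a) \<Rightarrow> nat \<Rightarrow> 'a \<Rightarrow> real" where
  "cp_model f y g k z = (MAX i\<in>{..k}. f (y i) + g i \<bullet> (z - y i))"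

definition f_best :: "('a \<Rightarrow> real) \<Rightarrow> (nat \<Rightarrow> 'a) \<Rightarrow> nat \<Rightarrow> real" where
  "f_best f y k = (MIN i\<in>{..k}. f (y i))"

definition gap :: "('a \<Rightarrow> real) \<Rightarrow> (nat \<Rightarrow> 'a) \<Rightarrow> (nat \<Rightarrow> real) \<Rightarrow> nat \<Rightarrow> real" where
  "gap f y flow k = f_best f y k - flow k"

definition level ::
  "('a \<Rightarrow> real) \<Rightarrow> real \<Rightarrow> (nat \<Rightarrow> 'a) \<Rightarrow> (nat \<Rightarrow> real) \<Rightarrow> nat \<Rightarrow> real" where
  "level f \<kappa> y flow k = f_best f y k - \<kappa> * gap f y flow k"

text \<open>
  The doubly stabilized subproblem, for a model \<open>m\<close>, level \<open>l\<close>, prox parameter \<open>\<mu>\<close> and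
  prox centre \<open>c\<close>: minimize \<open>r + \<mu>/2 * norm (z - c)^2\<close> over \<open>(z, r) \<in> S \<times> UNIV\<close> subject
  to \<open>m z \<le> r\<close> and \<open>r \<le> l\<close>.
\<close>

definition sub_objective :: "real \<Rightarrow> 'a::real_inner \<Rightarrow> 'a \<times> real \<Rightarrow> real" where
  "sub_objective \<mu> c = (\<lambda>(z, r). r + \<mu> / 2 * (norm (z - c))\<^sup>2)"

definition sub_solution ::
  "'a::real_inner set \<Rightarrow> ('a \<Rightarrow> real) \<Rightarrow> real \<Rightarrow> real \<Rightarrow> 'a \<Rightarrow> 'a \<times> real \<Rightarrow> bool" where
  "sub_solution S m l \<mu> c =
     is_arg_min (sub_objective \<mu> c) (\<lambda>(z, r). z \<in> S \<and> m z \<le> r \<and> r \<le> l)"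

text \<open>
  Lagrangian dual of the subproblem; only the two functional constraints are dualized, with
  multipliers \<open>t\<close> (for \<open>m z \<le> r\<close>) and \<open>\<tau>\<close> (for \<open>r \<le> l\<close>). The dual function is
  extended real valued because it is \<open>-\<infinity>\<close> unless \<open>1 - t + \<tau> = 0\<close>.
\<close>

definition sub_lagrangian ::
  "('a::real_inner \<Rightarrow> real) \<Rightarrow> real \<Rightarrow> real \<Rightarrow> 'a \<Rightarrow> real \<Rightarrow> real \<Rightarrow> 'a \<times> real \<Rightarrow> real" where
  "sub_lagrangian m l \<mu> c t \<tau> =
     (\<lambda>(z, r). sub_objective \<mu> c (z, r) + t * (m z - r) + \<tau> * (r - l))"

definition sub_dual ::
  "'a::real_inner set \<Rightarrow> ('a \<Rightarrow> real) \<Rightarrow> real \<Rightarrow> real \<Rightarrow> 'a \<Rightarrow> real \<Rightarrow> real \<Rightarrow> ereal" where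
  "sub_dual S m l \<mu> c t \<tau> = (INF p\<in>S \<times> UNIV. ereal (sub_lagrangian m l \<mu> c t \<tau> p))"

definition sub_dual_solution ::
  "'a::real_inner set \<Rightarrow> ('a \<Rightarrow> real) \<Rightarrow> real \<Rightarrow> real \<Rightarrow> 'a \<Rightarrow> real \<Rightarrow> real \<Rightarrow> bool" where
  "sub_dual_solution S m l \<mu> c t \<tau> \<longleftrightarrow>
     t \<ge> 0 \<and> \<tau> \<ge> 0 \<and>
     (\<forall>t'\<ge>0. \<forall>\<tau>'\<ge>0. sub_dual S m l \<mu> c t' \<tau>' \<le> sub_dual S m l \<mu> c t \<tau>)"

text \<open>
  A run of the algorithm in which the iterations \<open>k < N\<close> have been carried out without
  triggering the stopping test, so that exactly the points \<open>y k\<close> and \<open>x k\<close> with \<open>k \<le> N\<close>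
  are constrained; \<open>N = \<infinity>\<close> is a run that never stops. The run need not stop at
  iteration \<open>N\<close>, so every initial segment of a run is again a run. Any oracle choice of
  subgradients \<open>g\<close> and any update rule for the lower bounds \<open>flow\<close> are allowed.
\<close>

definition fdsa_run ::
  "'a::real_inner set \<Rightarrow> ('a \<Rightarrow> real) \<Rightarrow> real \<Rightarrow> real \<Rightarrow> (nat \<Rightarrow> real) \<Rightarrow> (nat \<Rightarrow> real) \<Rightarrow> enat \<Rightarrow>
   (nat \<Rightarrow> 'a) \<Rightarrow> (nat \<Rightarrow> 'a) \<Rightarrow> (nat \<Rightarrow> 'a) \<Rightarrow> (nat \<Rightarrow> real) \<Rightarrow> bool" where
  "fdsa_run S f \<kappa> \<epsilon> \<mu> \<beta> N x y g flow \<longleftrightarrow>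
     x 0 = y 0 \<and>
     (\<forall>k. enat k < N \<longrightarrow>
        g k \<in> subdifferential f (y k) \<and>
        flow k \<le> (INF z\<in>S. f z) \<and> 0 \<le> gap f y flow k \<and>
        \<not> (gap f y flow k \<le> \<epsilon> \<or> g k = 0) \<and>
        (\<exists>r. sub_solution S (cp_model f y g k) (level f \<kappa> y flow k) (\<mu> k) (x k) (y (Suc k), r)) \<and>
        x (Suc k) = y (Suc k) + nesterov_step k *\<^sub>R (y (Suc k) - y k)
                              + \<beta> k *\<^sub>R (y (Suc k) - x k))"

definition model_error ::
  "('a::real_inner \<Rightarrow> real) \<Rightarrow> (nat \<Rightarrow> 'a) \<Rightarrow> (nat \<Rightarrow> 'a) \<Rightarrow> nat \<Rightarrow> real" where
  "model_error f y g i = f (y (Suc i)) - cp_model f y g i (y (Suc i))"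

definition accumulated_error ::
  "('a::real_inner \<Rightarrow> real) \<Rightarrow> (nat \<Rightarrow> 'a) \<Rightarrow> (nat \<Rightarrow> 'a) \<Rightarrow> nat \<Rightarrow> real" where
  "accumulated_error f y g k =
     (\<Sum>i<k. (nesterov i)\<^sup>2 * model_error f y g i) / (nesterov (k - 1))\<^sup>2"

end

theory Submission
  imports Defs
begin

text \<open>
  A dual solution forces \<open>\<tau> = t - 1\<close>, and since the Lagrangian is strongly convex in
  \<open>z\<close>, the dual function is differentiable in \<open>t\<close> with slope \<open>m p - l\<close> at its unique
  minimizer \<open>p\<close>. Maximality in \<open>t\<close> then gives feasibility of \<open>p\<close> and complementary
  slackness, so \<open>p\<close> is the primal solution; no constraint qualification is needed. Hence
  the step is a proximal step on \<open>t * m\<close> over \<open>S\<close>, and the estimate follows from the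
  Beck--Teboulle analysis of accelerated proximal methods with step sizes \<open>t k / \<mu> k\<close>,
  the model error entering additively.
\<close>

subsection \<open>Nesterov's sequence\<close>

text \<open>The recursion gives \<open>nesterov (Suc k) \<ge> nesterov k + 1/2\<close>. This linear
  growth is what turns the weight \<open>1 / (nesterov (k - 1))\<^sup>2\<close> into the rate
  \<open>4 / (k + 1)\<^sup>2\<close>.\<close>

lemma nesterov_ge: "(real k + 2) / 2 \<le> nesterov k"
proof (induction k)
  case (Suc k)
  have "2 * nesterov k = sqrt ((2 * nesterov k)\<^sup>2)"
    using Suc by (subst real_sqrt_abs) simp
  also have "\<dots> \<le> sqrt (1 + 4 * (nesterov k)\<^sup>2)"
    by (intro real_sqrt_le_mono) (simp add: power_mult_distrib)
  finally show ?case
    using Suc by simp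
qed simp

lemma nesterov_ge_1: "1 \<le> nesterov k"
  using nesterov_ge[of k] by simp

text \<open>The recursion picks the positive root of this quadratic, so that the weights of the
  objective gaps telescope in the energy estimate.\<close>

lemma nesterov_Suc_square: "(nesterov (Suc k))\<^sup>2 - nesterov (Suc k) = (nesterov k)\<^sup>2"
proof -
  have "(sqrt (1 + 4 * (nesterov k)\<^sup>2))\<^sup>2 = 1 + 4 * (nesterov k)\<^sup>2"
    by (simp add: add_nonneg_nonneg)
  then show ?thesis
    by (simp add: power2_eq_square field_simps)
qed

lemma nesterov_Suc_mult_step: "nesterov (Suc k) * nesterov_step k = nesterov k - 1"
  using nesterov_ge_1[of "Suc k"] by (simp add: nesterov_step_def del: nesterov.simps)

subsection \<open>The cutting-plane model\<close>

lemma cp_model_le: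
  assumes "\<And>i. i \<le> k \<Longrightarrow> g i \<in> subdifferential f (y i)"
  shows "cp_model f y g k z \<le> f z"
  using assms by (auto simp: cp_model_def subdifferential_def)

lemma convex_on_cp_model: "convex_on UNIV (cp_model f y g k)"
proof (rule convex_onI)
  fix a :: real and u v :: 'a
  assume a: "0 < a" "a < 1"
  have le: "f (y i) + g i \<bullet> (z - y i) \<le> cp_model f y g k z" if "i \<le> k" for i z
    using that by (auto simp: cp_model_def intro!: Max_ge)
  have "f (y i) + g i \<bullet> ((1 - a) *\<^sub>R u + a *\<^sub>R v - y i)
      \<le> (1 - a) * cp_model f y g k u + a * cp_model f y g k v" if "i \<le> k" for i
  proof -
    have "f (y i) + g i \<bullet> ((1 - a) *\<^sub>R u + a *\<^sub>R v - y i)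
        = (1 - a) * (f (y i) + g i \<bullet> (u - y i)) + a * (f (y i) + g i \<bullet> (v - y i))"
      by (simp add: inner_simps algebra_simps)
    also have "\<dots> \<le> (1 - a) * cp_model f y g k u + a * cp_model f y g k v"
      using a le[OF that] by (intro add_mono mult_left_mono) auto
    finally show ?thesis .
  qed
  then show "cp_model f y g k ((1 - a) *\<^sub>R u + a *\<^sub>R v)
      \<le> (1 - a) * cp_model f y g k u + a * cp_model f y g k v"
    by (subst cp_model_def) auto
qed simp

subsection \<open>Primal solutions from dual solutions\<close>

text \<open>Strong convexity without subgradients or normal cones: compare \<open>p\<close> with
  \<open>(1 - a) p + a z\<close>, divide by \<open>a\<close>, and let \<open>a\<close> tend to
  0.\<close>

lemma prox_min_quadratic_growth:
  fixes \<psi> :: "'a::real_inner \<Rightarrow> real"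
  assumes conv: "convex_on S \<psi>" and p: "p \<in> S" and z: "z \<in> S"
    and min: "\<And>w. w \<in> S \<Longrightarrow>
      \<psi> p + \<mu> / 2 * (norm (p - c))\<^sup>2 \<le> \<psi> w + \<mu> / 2 * (norm (w - c))\<^sup>2"
  shows "\<psi> p + \<mu> / 2 * (norm (p - c))\<^sup>2 + \<mu> / 2 * (norm (z - p))\<^sup>2
    \<le> \<psi> z + \<mu> / 2 * (norm (z - c))\<^sup>2"
proof -
  define D where "D = \<psi> z + \<mu> / 2 * (norm (z - c))\<^sup>2 - (\<psi> p + \<mu> / 2 * (norm (p - c))\<^sup>2)"
  have bound: "(1 - a) * (\<mu> / 2 * (norm (z - p))\<^sup>2) \<le> D" if a: "0 < a" "a < 1" for a
  proof -
    define w where "w = (1 - a) *\<^sub>R p + a *\<^sub>R z"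
    have "w \<in> S"
      using conv p z a unfolding w_def convex_on_def by (auto intro: convexD)
    then have "\<psi> p + \<mu> / 2 * (norm (p - c))\<^sup>2 \<le> \<psi> w + \<mu> / 2 * (norm (w - c))\<^sup>2"
      by (rule min)
    also have "\<psi> w \<le> (1 - a) * \<psi> p + a * \<psi> z"
      unfolding w_def using a by (intro convex_onD[OF conv]) (auto simp: p z)
    also have "(norm (w - c))\<^sup>2
        = (1 - a) * (norm (p - c))\<^sup>2 + a * (norm (z - c))\<^sup>2 - a * (1 - a) * (norm (z - p))\<^sup>2"
      unfolding w_def power2_norm_eq_inner
      by (simp add: inner_simps inner_commute algebra_simps)
    finally have "a * ((1 - a) * (\<mu> / 2 * (norm (z - p))\<^sup>2)) \<le> a * D"
      by (simp add: D_def field_simps)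
    then show ?thesis
      using a by simp
  qed
  have "((\<lambda>a. (1 - a) * (\<mu> / 2 * (norm (z - p))\<^sup>2)) \<longlongrightarrow> (1 - 0) * (\<mu> / 2 * (norm (z - p))\<^sup>2))
      (at_right 0)"
    by (intro tendsto_intros)
  moreover have "\<forall>\<^sub>F a in at_right 0. (1 - a) * (\<mu> / 2 * (norm (z - p))\<^sup>2) \<le> D"
    by (rule eventually_mono[OF eventually_at_right_real[of 0 1]]) (use bound in auto)
  ultimately have "(1 - 0) * (\<mu> / 2 * (norm (z - p))\<^sup>2) \<le> D"
    by (rule tendsto_upperbound) simp
  then show ?thesis
    by (simp add: D_def)
qed

text \<open>The differentiability of the dual function, in one-sided quantitative form.\<close>

lemma perturbed_min_increases:
  fixes \<phi> \<psi> :: "'a::real_normed_vector \<Rightarrow> real"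
  assumes S: "compact S" and p: "p \<in> S" and cont: "continuous_on S \<psi>" and pos: "0 < \<psi> p"
    and c: "0 < c" and b: "0 < b"
    and growth: "\<And>z. z \<in> S \<Longrightarrow> \<phi> p + c * (norm (z - p))\<^sup>2 \<le> \<phi> z"
  obtains \<delta> \<eta> where "0 < \<delta>" "\<delta> \<le> b" "0 < \<eta>"
    "\<And>z. z \<in> S \<Longrightarrow> \<phi> p + \<eta> \<le> \<phi> z + \<delta> * \<psi> z"
proof -
  obtain \<rho> where \<rho>: "0 < \<rho>" "\<And>z. z \<in> S \<Longrightarrow> dist z p < \<rho> \<Longrightarrow> dist (\<psi> z) (\<psi> p) < \<psi> p / 2"
    using cont p pos unfolding continuous_on_iff by (meson half_gt_zero)
  obtain q where q: "\<And>z. z \<in> S \<Longrightarrow> \<psi> q \<le> \<psi> z"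
    using continuous_attains_inf[OF S _ cont] p by auto
  define B where "B = \<bar>\<psi> q\<bar> + 1"
  have B: "0 < B" "\<And>z. z \<in> S \<Longrightarrow> - B \<le> \<psi> z"
    using q by (fastforce simp: B_def)+
  \<comment> \<open>Outside the \<open>\<rho>\<close>-ball the perturbation costs at most
    \<open>\<delta> * B\<close>, which this choice keeps below half of the growth
    \<open>c * \<rho>\<^sup>2\<close>; inside the ball \<open>\<psi>\<close> stays above
    \<open>\<psi> p / 2\<close>. \<open>\<eta>\<close> is the smaller of the two gains.\<close>
  define \<delta> where "\<delta> = min b (c * \<rho>\<^sup>2 / (2 * B))"
  define \<eta> where "\<eta> = min (\<delta> * (\<psi> p / 2)) (c * \<rho>\<^sup>2 / 2)"
  have \<delta>: "0 < \<delta>" "\<delta> \<le> b" "\<delta> * B \<le> c * \<rho>\<^sup>2 / 2"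
    using b c \<rho>(1) B(1) by (auto simp: \<delta>_def min_def field_simps)
  show thesis
  proof (rule that[of \<delta> \<eta>])
    show "0 < \<eta>"
      using \<delta> pos c \<rho>(1) by (simp add: \<eta>_def)
    fix z assume z: "z \<in> S"
    show "\<phi> p + \<eta> \<le> \<phi> z + \<delta> * \<psi> z"
    proof (cases "dist z p < \<rho>")
      case True
      then have "\<psi> p / 2 \<le> \<psi> z"
        using \<rho>(2)[OF z True] unfolding dist_real_def by linarith
      then have "\<delta> * (\<psi> p / 2) \<le> \<delta> * \<psi> z"
        using \<delta>(1) by (intro mult_left_mono) auto
      moreover have "0 \<le> c * (norm (z - p))\<^sup>2"
        using c by simp
      ultimately show ?thesis
        using growth[OF z] unfolding \<eta>_def by linarith
    next
      case False
      then have "c * \<rho>\<^sup>2 \<le> c * (norm (z - p))\<^sup>2"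
        using c \<rho>(1) by (intro mult_left_mono power_mono) (auto simp: dist_norm)
      moreover have "\<delta> * (- B) \<le> \<delta> * \<psi> z"
        using \<delta>(1) B(2)[OF z] by (intro mult_left_mono) auto
      ultimately show ?thesis
        using growth[OF z] \<delta>(3) unfolding \<eta>_def by linarith
    qed
  qed (use \<delta> in auto)
qed

lemma sub_dual_le:
  assumes "z \<in> S"
  shows "sub_dual S m l \<mu> c t \<tau> \<le> ereal (sub_lagrangian m l \<mu> c t \<tau> (z, r))"
  unfolding sub_dual_def using assms by (intro INF_lower) auto

lemma sub_lagrangian_balanced:
  "sub_lagrangian m l \<mu> c t (t - 1) (z, r)
    = t * m z + \<mu> / 2 * (norm (z - c))\<^sup>2 - (t - 1) * l"
  by (simp add: sub_lagrangian_def sub_objective_def algebra_simps)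

lemma sub_dual_ge:
  assumes "\<And>z. z \<in> S \<Longrightarrow> d \<le> t * m z + \<mu> / 2 * (norm (z - c))\<^sup>2 - (t - 1) * l"
  shows "ereal d \<le> sub_dual S m l \<mu> c t (t - 1)"
  unfolding sub_dual_def using assms
  by (auto intro!: INF_greatest simp: sub_lagrangian_balanced)

text \<open>Takes the place of the KKT conditions: the inequality characterizes a proximal step on
  \<open>m\<close> of length \<open>t / \<mu>\<close>, and \<open>1 \<le> t\<close> permits the
  later division by \<open>t\<close>.\<close>

lemma sub_solution_prox:
  fixes S :: "'a::real_inner set"
  assumes S: "compact S" and conv: "convex_on S m" and cont: "continuous_on S m"
    and \<mu>: "0 < \<mu>"
    and primal: "sub_solution S m l \<mu> c (p, r)"
    and dual: "sub_dual_solution S m l \<mu> c t \<tau>"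
  shows "1 \<le> t" and "p \<in> S"
    and "\<And>z. z \<in> S \<Longrightarrow> t * m p + \<mu> / 2 * (norm (p - c))\<^sup>2 + \<mu> / 2 * (norm (z - p))\<^sup>2
      \<le> t * m z + \<mu> / 2 * (norm (z - c))\<^sup>2"
proof -
  have p: "p \<in> S" "m p \<le> r" "r \<le> l"
    using primal by (auto simp: sub_solution_def is_arg_min_def)
  have p_min: "r + \<mu> / 2 * (norm (p - c))\<^sup>2 \<le> m z + \<mu> / 2 * (norm (z - c))\<^sup>2"
    if "z \<in> S" "m z \<le> l" for z
    using primal that
    by (fastforce simp: sub_solution_def is_arg_min_def sub_objective_def not_less)
  have t0: "0 \<le> t" and \<tau>0: "0 \<le> \<tau>"
    and dmax: "\<And>t' \<tau>'. 0 \<le> t' \<Longrightarrow> 0 \<le> \<tau>' \<Longrightarrow>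
      sub_dual S m l \<mu> c t' \<tau>' \<le> sub_dual S m l \<mu> c t \<tau>"
    using dual by (auto simp: sub_dual_solution_def)
  have Sne: "S \<noteq> {}"
    using p by auto

  obtain q where q: "\<And>z. z \<in> S \<Longrightarrow> m q \<le> m z"
    using continuous_attains_inf[OF S Sne cont] by auto
  \<comment> \<open>The multipliers \<open>(1, 0)\<close> show that the optimal dual value is not
    \<open>-\<infinity>\<close>.\<close>
  have "ereal (m q) \<le> sub_dual S m l \<mu> c 1 (1 - 1)"
    using \<mu> by (intro sub_dual_ge) (simp add: q add_increasing2)
  also have "\<dots> \<le> sub_dual S m l \<mu> c t \<tau>"
    by (intro dmax) auto
  finally have dual_finite: "m q \<le> sub_lagrangian m l \<mu> c t \<tau> (p, r')" for r'
    using sub_dual_le[OF p(1), of m l \<mu> c t \<tau> r'] order_trans by fastforce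
  have \<tau>: "\<tau> = t - 1"
  proof (rule ccontr)
    assume "\<tau> \<noteq> t - 1"
    then have nz: "1 - t + \<tau> \<noteq> 0"
      by simp
    \<comment> \<open>The Lagrangian is affine in \<open>r'\<close> with nonzero slope, so some
      \<open>r'\<close> brings it to \<open>m q - 1\<close>, below the dual value.\<close>
    define C where "C = \<mu> / 2 * (norm (p - c))\<^sup>2 + t * m p - \<tau> * l"
    have "sub_lagrangian m l \<mu> c t \<tau> (p, r') = (1 - t + \<tau>) * r' + C" for r'
      by (simp add: sub_lagrangian_def sub_objective_def C_def algebra_simps)
    then have "m q \<le> (1 - t + \<tau>) * ((m q - C - 1) / (1 - t + \<tau>)) + C"
      using dual_finite by metis
    also have "\<dots> = m q - 1"
      using nz by (simp only: nonzero_mult_div_cancel_left times_divide_eq_right) simp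
    finally show False
      by simp
  qed
  then show t1: "1 \<le> t"
    using \<tau>0 by simp

  define \<Phi> where "\<Phi> z = t * m z + \<mu> / 2 * (norm (z - c))\<^sup>2" for z
  have "continuous_on S \<Phi>"
    unfolding \<Phi>_def by (intro continuous_intros cont)
  then obtain w where w: "w \<in> S" "\<And>z. z \<in> S \<Longrightarrow> \<Phi> w \<le> \<Phi> z"
    using continuous_attains_inf[OF S Sne] by blast
  have growth: "\<Phi> w + \<mu> / 2 * (norm (z - w))\<^sup>2 \<le> \<Phi> z" if "z \<in> S" for z
    unfolding \<Phi>_def
    using prox_min_quadratic_growth[OF convex_on_cmul[OF t0 conv] w(1) that, of \<mu> c] w(2)
    by (simp add: \<Phi>_def)
  have dual_le: "sub_dual S m l \<mu> c t \<tau> \<le> ereal (\<Phi> w - (t - 1) * l)"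
    using sub_dual_le[OF w(1), of m l \<mu> c t \<tau>] by (simp add: \<tau> sub_lagrangian_balanced \<Phi>_def)
  \<comment> \<open>Moving along \<open>\<tau> = t - 1\<close> from \<open>t\<close> to
    \<open>t'\<close> adds \<open>(t' - t) * (m z - l)\<close> to the Lagrangian. A uniform gain
    \<open>\<eta>\<close> would beat the dual optimum; \<open>1 \<le> t'\<close> keeps the second
    multiplier nonnegative.\<close>
  have no_increase: False
    if "0 < \<eta>" "1 \<le> t'" "\<And>z. z \<in> S \<Longrightarrow> \<Phi> w + \<eta> \<le> \<Phi> z + (t' - t) * (m z - l)" for \<eta> t'
  proof -
    have "ereal (\<Phi> w - (t - 1) * l + \<eta>) \<le> sub_dual S m l \<mu> c t' (t' - 1)"
      using that(3) by (intro sub_dual_ge) (force simp: \<Phi>_def algebra_simps)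
    also have "\<dots> \<le> sub_dual S m l \<mu> c t \<tau>"
      using that(2) by (intro dmax) auto
    finally have "ereal (\<Phi> w - (t - 1) * l + \<eta>) \<le> ereal (\<Phi> w - (t - 1) * l)"
      using dual_le by (rule order_trans)
    then show False
      using that(1) by simp
  qed
  have w_feasible: "m w \<le> l"
  proof (rule ccontr)
    assume "\<not> m w \<le> l"
    then obtain \<delta> \<eta> where "0 < \<delta>" "\<delta> \<le> 1" "0 < \<eta>"
        "\<And>z. z \<in> S \<Longrightarrow> \<Phi> w + \<eta> \<le> \<Phi> z + \<delta> * (m z - l)"
      using perturbed_min_increases[OF S w(1) continuous_on_diff[OF cont continuous_on_const[of S l]], of "\<mu> / 2" 1 \<Phi>] \<mu> growth
      by auto
    then show False
      using no_increase[of \<eta> "t + \<delta>"] t1 by simp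
  qed
  have w_slack: "(t - 1) * (m w - l) = 0"
  proof (rule ccontr)
    assume "(t - 1) * (m w - l) \<noteq> 0"
    then have "1 < t" "m w < l"
      using t1 w_feasible by auto
    \<comment> \<open>Here \<open>t\<close> is lowered instead of raised; the bound
      \<open>t - 1\<close> on \<open>\<delta>\<close> keeps \<open>t - \<delta>\<close> at least
      1.\<close>
    then obtain \<delta> \<eta> where "0 < \<delta>" "\<delta> \<le> t - 1" "0 < \<eta>"
        "\<And>z. z \<in> S \<Longrightarrow> \<Phi> w + \<eta> \<le> \<Phi> z + \<delta> * (l - m z)"
      using perturbed_min_increases[OF S w(1) continuous_on_diff[OF continuous_on_const[of S l] cont], of "\<mu> / 2" "t - 1" \<Phi>] \<mu> growth
      by auto
    then show False
      using no_increase[of \<eta> "t - \<delta>"] by (simp add: algebra_simps)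
  qed
  \<comment> \<open>Primal optimality of \<open>p\<close> against the feasible point
    \<open>w\<close> makes \<open>p\<close> a minimizer of \<open>\<Phi>\<close> too, and quadratic
    growth at \<open>w\<close> forces \<open>p = w\<close>.\<close>
  have "(t - 1) * (m p - l) \<le> 0"
    using t1 p by (intro mult_nonneg_nonpos) auto
  then have "\<Phi> p \<le> m p + \<mu> / 2 * (norm (p - c))\<^sup>2 + (t - 1) * l"
    by (simp add: \<Phi>_def algebra_simps)
  also have "\<dots> \<le> m w + \<mu> / 2 * (norm (w - c))\<^sup>2 + (t - 1) * l"
    using p_min[OF w(1) w_feasible] p by simp
  also have "\<dots> = \<Phi> w"
    using w_slack by (simp add: \<Phi>_def algebra_simps)
  finally have "\<mu> / 2 * (norm (p - w))\<^sup>2 \<le> 0"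
    using growth[OF p(1)] by simp
  then have "p = w"
    using \<mu> by (simp add: mult_le_0_iff)
  then show "p \<in> S" and "\<And>z. z \<in> S \<Longrightarrow>
      t * m p + \<mu> / 2 * (norm (p - c))\<^sup>2 + \<mu> / 2 * (norm (z - p))\<^sup>2
        \<le> t * m z + \<mu> / 2 * (norm (z - c))\<^sup>2"
    using w(1) growth by (auto simp: \<Phi>_def)
qed

subsection \<open>The accelerated descent inequality\<close>

text \<open>The guard on \<open>at_y\<close> is for the first step, where \<open>y 0\<close> need not lie in \<open>S\<close>.\<close>

lemma accelerated_descent:
  fixes p x y z :: "'a::real_inner"
  assumes L: "1 \<le> L" and M: "0 \<le> M"
    and at_z: "Fp - e + M / 2 * ((norm (p - x))\<^sup>2 + (norm (z - p))\<^sup>2 - (norm (z - x))\<^sup>2) \<le> Fz"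
    and at_y: "L \<noteq> 1 \<Longrightarrow>
      Fp - e + M / 2 * ((norm (p - x))\<^sup>2 + (norm (y - p))\<^sup>2 - (norm (y - x))\<^sup>2) \<le> Fy"
  shows "L\<^sup>2 * (Fp - Fz) + M / 2 * (norm (L *\<^sub>R p - (L - 1) *\<^sub>R y - z))\<^sup>2
    \<le> (L\<^sup>2 - L) * (Fy - Fz) + M / 2 * (norm (L *\<^sub>R x - (L - 1) *\<^sub>R y - z))\<^sup>2 + L\<^sup>2 * e"
proof -
  define A where "A v = (norm (p - x))\<^sup>2 + (norm (v - p))\<^sup>2 - (norm (v - x))\<^sup>2" for v
  define U where "U = (norm (L *\<^sub>R p - (L - 1) *\<^sub>R y - z))\<^sup>2"
  define V where "V = (norm (L *\<^sub>R x - (L - 1) *\<^sub>R y - z))\<^sup>2"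
  \<comment> \<open>The inequalities at \<open>z\<close> and \<open>y\<close> are combined with
    weights \<open>L\<close> and \<open>L * (L - 1)\<close>, which sum to \<open>L\<^sup>2\<close>.
    The square of \<open>L *\<^sub>R (p - x)\<close> is then dropped.\<close>
  have "(norm (L *\<^sub>R p - (L - 1) *\<^sub>R y - z))\<^sup>2 + (norm (L *\<^sub>R (p - x)))\<^sup>2
      = (norm (L *\<^sub>R x - (L - 1) *\<^sub>R y - z))\<^sup>2 + L * A z + L * (L - 1) * A y"
    unfolding A_def power2_norm_eq_inner
    by (simp add: inner_simps inner_commute algebra_simps)
  then have "U \<le> V + (L * A z + L * (L - 1) * A y)"
    unfolding U_def V_def by (smt (verit) zero_le_power2)
  then have "M / 2 * U \<le> M / 2 * (V + (L * A z + L * (L - 1) * A y))"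
    using M by (intro mult_left_mono) auto
  moreover have "L * (Fp - e + M / 2 * A z) \<le> L * Fz"
    using at_z L unfolding A_def by (intro mult_left_mono) auto
  moreover have "L * (L - 1) * (Fp - e + M / 2 * A y) \<le> L * (L - 1) * Fy"
    using at_y L unfolding A_def by (cases "L = 1") (auto intro!: mult_left_mono)
  ultimately show ?thesis
    unfolding U_def[symmetric] V_def[symmetric]
    by (simp add: field_simps power2_eq_square)
qed

theorem theorem2:
  fixes S :: "(real ^ 'n) set" and f :: "real ^ 'n \<Rightarrow> real"
    and x y g :: "nat \<Rightarrow> real ^ 'n" and xstar :: "real ^ 'n"
    and flow \<mu> \<beta> t \<tau> :: "nat \<Rightarrow> real" and \<kappa> \<epsilon> \<mu>' :: real and N :: enat
  assumes "S \<noteq> {}" and "convex S" and "compact S"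
    and "convex_on UNIV f"
    and "is_arg_min f (\<lambda>z. z \<in> S) xstar"
    and "0 < \<kappa>" and "\<kappa> < 1"
    and "\<And>k. 0 < \<mu> k"
    and "\<And>k. \<beta> k = 0"
    and "fdsa_run S f \<kappa> \<epsilon> \<mu> \<beta> N x y g flow"
    and "\<And>k. enat k < N \<Longrightarrow>
           sub_dual_solution S (cp_model f y g k) (level f \<kappa> y flow k) (\<mu> k) (x k) (t k) (\<tau> k)"
    and "0 < \<mu>'" and "\<mu> 0 = \<mu>'"
    and "\<And>k. 1 \<le> k \<Longrightarrow> enat k < N \<Longrightarrow> \<mu> k * t (k - 1) \<le> \<mu> (k - 1) * t k"
  shows "\<forall>k\<ge>1. enat k \<le> N \<longrightarrow>
           f (y k) - (INF z\<in>S. f z)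
             \<le> 2 * \<mu>' * (norm (x 0 - xstar))\<^sup>2 / (t 0 * (real k + 1)\<^sup>2) + accumulated_error f y g k"
proof -
  note convS = assms(2) and compS = assms(3) and xs = assms(5)
    and \<mu> = assms(8) and \<beta> = assms(9) and run = assms(10) and dual = assms(11)
    and \<mu>0 = assms(13) and mono = assms(14)
  have xs_in: "xstar \<in> S" and xs_min: "\<And>z. z \<in> S \<Longrightarrow> f xstar \<le> f z"
    using xs by (auto simp: is_arg_min_def not_less)
  have fmin: "(INF z\<in>S. f z) = f xstar"
    using xs_in xs_min by (intro cInf_eq_minimum) auto
  \<comment> \<open>The inverse step size; the assumption relating \<open>\<mu>\<close> and
    \<open>t\<close> says exactly that \<open>M\<close> is nonincreasing.\<close>
  define M where "M k = \<mu> k / t k" for k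
  define u where "u k = nesterov k *\<^sub>R y (Suc k) - (nesterov k - 1) *\<^sub>R y k - xstar" for k

  have step: "1 \<le> t k \<and> y (Suc k) \<in> S \<and> (\<forall>z\<in>S. f (y (Suc k)) - model_error f y g k +
      M k / 2 * ((norm (y (Suc k) - x k))\<^sup>2 + (norm (z - y (Suc k)))\<^sup>2 - (norm (z - x k))\<^sup>2) \<le> f z)"
    if k: "enat k < N" for k
  proof -
    let ?m = "cp_model f y g k" and ?p = "y (Suc k)"
    obtain r where sol: "sub_solution S ?m (level f \<kappa> y flow k) (\<mu> k) (x k) (?p, r)"
      using run k unfolding fdsa_run_def by blast
    have conv: "convex_on S ?m"
      using convex_on_cp_model convS convex_on_subset by blast
    have cont: "continuous_on S ?m"
      using convex_on_continuous[OF open_UNIV convex_on_cp_model] continuous_on_subset by blast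
    note prox = sub_solution_prox[OF compS conv cont \<mu> sol dual[OF k]]
    have "f ?p - model_error f y g k +
      M k / 2 * ((norm (?p - x k))\<^sup>2 + (norm (z - ?p))\<^sup>2 - (norm (z - x k))\<^sup>2) \<le> f z"
      if z: "z \<in> S" for z
    proof -
      have "f ?p - model_error f y g k +
          M k / 2 * ((norm (?p - x k))\<^sup>2 + (norm (z - ?p))\<^sup>2 - (norm (z - x k))\<^sup>2) \<le> ?m z"
        \<comment> \<open>Division by \<open>t k\<close>. By definition of the model error,
          \<open>f ?p - model_error f y g k\<close> is the model value at \<open>?p\<close>.\<close>
        using prox(3)[OF z] prox(1) by (simp add: model_error_def M_def field_simps)
      also have "\<dots> \<le> f z"
      proof (rule cp_model_le)
        fix i assume "i \<le> k"
        then have "enat i < N"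
          using k by (meson enat_ord_simps(1) order_le_less_trans)
        then show "g i \<in> subdifferential f (y i)"
          using run unfolding fdsa_run_def by blast
      qed
      finally show ?thesis .
    qed
    then show ?thesis
      using prox(1,2) by blast
  qed

  \<comment> \<open>The left side is the potential: iteration \<open>k\<close> raises it by at most
    \<open>(nesterov k)\<^sup>2 * model_error f y g k\<close>.\<close>
  have energy: "(nesterov k)\<^sup>2 * (f (y (Suc k)) - f xstar) + M k / 2 * (norm (u k))\<^sup>2
      \<le> M 0 / 2 * (norm (x 0 - xstar))\<^sup>2 + (\<Sum>i<Suc k. (nesterov i)\<^sup>2 * model_error f y g i)"
    if "enat k < N" for k
    using that
  proof (induction k)
    case 0
    have "0 \<le> M 0"
      using step[OF 0] \<mu>[of 0] by (simp add: M_def)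
    \<comment> \<open>Since \<open>nesterov 0 = 1\<close>, the coefficient
      \<open>L\<^sup>2 - L\<close> vanishes and \<open>y 0\<close> drops out.\<close>
    then show ?case
      using accelerated_descent[of 1 "M 0" "f (y (Suc 0))" "model_error f y g 0" "y (Suc 0)" "x 0"
          xstar "f xstar" "y 0" "f (y 0)"] step[OF 0] xs_in
      by (simp add: u_def)
  next
    case (Suc k)
    let ?L = "nesterov (Suc k)"
    have k: "enat k < N"
      using Suc.prems by (meson enat_ord_simps(2) lessI order_less_trans)
    note st = step[OF Suc.prems] and st' = step[OF k]
    have M: "0 \<le> M (Suc k)" "M (Suc k) \<le> M k"
      using st st' \<mu>[of "Suc k"] mono[OF _ Suc.prems] by (auto simp: M_def field_simps)
    have "x (Suc k) = y (Suc k) + nesterov_step k *\<^sub>R (y (Suc k) - y k)"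
      using run k \<beta> unfolding fdsa_run_def by simp
    then have "?L *\<^sub>R x (Suc k)
        = ?L *\<^sub>R y (Suc k) + (?L * nesterov_step k) *\<^sub>R (y (Suc k) - y k)"
      by (simp add: scaleR_add_right del: nesterov.simps)
    \<comment> \<open>The extrapolation rule is designed for this: the shifted prox centre of the
      new iteration is the old \<open>u k\<close>, so the squared distances telescope.\<close>
    then have u_eq: "?L *\<^sub>R x (Suc k) - (?L - 1) *\<^sub>R y (Suc k) - xstar = u k"
      unfolding nesterov_Suc_mult_step u_def by (simp add: algebra_simps del: nesterov.simps)
    have "?L\<^sup>2 * (f (y (Suc (Suc k))) - f xstar) + M (Suc k) / 2 * (norm (u (Suc k)))\<^sup>2
        \<le> (nesterov k)\<^sup>2 * (f (y (Suc k)) - f xstar) + M (Suc k) / 2 * (norm (u k))\<^sup>2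
          + ?L\<^sup>2 * model_error f y g (Suc k)"
      using accelerated_descent[OF nesterov_ge_1 M(1), of "f (y (Suc (Suc k)))"
          "model_error f y g (Suc k)" "y (Suc (Suc k))" "x (Suc k)" xstar "f xstar"
          "Suc k" "y (Suc k)" "f (y (Suc k))"] st st' xs_in
      unfolding u_eq nesterov_Suc_square u_def[of "Suc k"] by blast
    also have "M (Suc k) / 2 * (norm (u k))\<^sup>2 \<le> M k / 2 * (norm (u k))\<^sup>2"
      using M(2) by (intro mult_right_mono) auto
    finally show ?case
      using Suc.IH[OF k] by (simp del: nesterov.simps)
  qed

  show ?thesis
  proof (intro allI impI)
    fix k :: nat
    assume "1 \<le> k" and kN: "enat k \<le> N"
    \<comment> \<open>The point \<open>y k\<close> is produced by iteration
      \<open>j = k - 1\<close>, hence \<open>k \<le> N\<close> suffices and the weight has index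
      \<open>k - 1\<close>.\<close>
    then obtain j where j: "k = Suc j"
      by (cases k) auto
    have jN: "enat j < N"
      using kN unfolding j by (meson enat_ord_simps(2) lessI order_less_le_trans)
    then have "enat 0 < N"
      by (meson enat_ord_simps(1) le0 order_le_less_trans)
    then have M0: "0 \<le> M 0"
      using step[of 0] \<mu>[of 0] by (simp add: M_def)
    let ?L = "nesterov j" and ?R = "(norm (x 0 - xstar))\<^sup>2"
      and ?E = "\<Sum>i<k. (nesterov i)\<^sup>2 * model_error f y g i"
    have L: "0 < ?L"
      using nesterov_ge_1[of j] by simp
    have "0 \<le> M j / 2 * (norm (u j))\<^sup>2"
      using step[OF jN] \<mu>[of j] by (simp add: M_def)
    then have "?L\<^sup>2 * (f (y k) - f xstar) \<le> M 0 / 2 * ?R + ?E"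
      using energy[OF jN] unfolding j by linarith
    then have "f (y k) - f xstar \<le> (M 0 / 2 * ?R + ?E) / ?L\<^sup>2"
      using L by (simp add: pos_le_divide_eq mult.commute)
    also have "\<dots> = M 0 / 2 * ?R / ?L\<^sup>2 + accumulated_error f y g k"
      by (simp add: accumulated_error_def j add_divide_distrib)
    \<comment> \<open>\<open>nesterov j\<close> is at least
      \<open>(j + 2) / 2 = (k + 1) / 2\<close>.\<close>
    also have "M 0 / 2 * ?R / ?L\<^sup>2 \<le> M 0 / 2 * ?R / ((real k + 1) / 2)\<^sup>2"
      using nesterov_ge[of j] M0 unfolding j
      by (intro divide_left_mono power_mono mult_pos_pos zero_less_power L) auto
    also have "\<dots> = 2 * \<mu>' * ?R / (t 0 * (real k + 1)\<^sup>2)"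
      by (simp add: M_def \<mu>0 power_divide)
    finally show "f (y k) - (INF z\<in>S. f z)
        \<le> 2 * \<mu>' * ?R / (t 0 * (real k + 1)\<^sup>2) + accumulated_error f y g k"
      by (simp add: fmin)
  qed
qed

end
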